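(* For each $N\in\mathbb{N}$ let $\mu_0^{\infty,N}$ be the uniform distribution on the simplex $\Delta_{N-1}=\{(x_1,\dots,x_N): x_i\ge 0,\ \sum_{i=1}^N x_i=1\}$ (so the total wealth is fixed and equal to $1$ for each $N$), and consider the empirical measure on $\mathbb{R}_+$ $$\mu_0^N=\frac1N\sum_{i=1}^N\delta_{X_0^{i,N}},\qquad (X_0^{1,N},\dots,X_0^{N,N})\sim\mu_0^{\infty,N}.$$ Then, as $N\to\infty$, $$\mu_0^N\Longrightarrow\delta_0\quad\text{almost surely.}$$ In particular, the assumptions (H) of the mean-field limit theorem, listed in the context, hold and, since $w_0=1$, the sub-linear growth result (S), stated in the context, is in effect: for the empirical measures $\mu_t^N$ of the random-exchange dynamics started from $\mu_0^N$, one has $\lim_{N\to\infty}\mu_t^N=\delta_0$ in probability for all times $t$.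
   Context: The random vectors for different $N$ are defined on a common probability space. The symbol $\Rightarrow$ denotes weak convergence of probability measures on $\mathbb{R}_+=[0,\infty)$, and $\langle g,\mu\rangle=\int_{\mathbb{R}_+}g(x)\,\mu(dx)$. Dynamics: there are $N$ agents with non-negative wealths $X_t^{1,N},\dots,X_t^{N,N}$ and total wealth $W_N=\sum_{i=1}^N X_t^{i,N}$, which is conserved in time. Ordered pairs $(i,j)$ of distinct agents are chosen uniformly at random and interact at the events of a Poisson process. In an interaction, the wealths $(X^{i,N},X^{j,N})$ are replaced by $\big(r(X^{i,N}+X^{j,N}),(1-r)(X^{i,N}+X^{j,N})\big)$, with $r$ uniform on $[0,1]$ and independent of the past. The empirical measure is $\mu_t^N=\frac1N\sum_{i=1}^N\delta_{X_t^{i,N}}$. With an interaction rate of $1/N$, it is a Markov process with generator $$\mathcal{G}F(\mu^N)=\int_0^1\int_{\mathbb{R}_+}\int_{\mathbb{R}_+}\{F(\mu^{(x,y,r),N})-F(\mu^N)\}\,\mathbf 1_{\{x+y\le W_N\}}\,N\mu^{(2,N)}(dx,dy)\,dr,$$ where $\mu^{(x,y,r),N}=\mu^N-\frac1N\delta_x-\frac1N\delta_y+\frac1N\delta_{r(x+y)}+\frac1N\delta_{(1-r)(x+y)}$ and $\mu^{(2,N)}(A\times B)=\mu^N(A)\mu^N(B)-\frac1N\mu^N(A\cap B)$ for Borel sets $A,B$. In the proposition $W_N=1$ for all $N$. Assumptions (H) of the mean-field limit theorem: $W_N$ is a non-decreasing sequence converging to some $w_0\in(0,\infty]$ as $N\to\infty$;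 and for a given measure $\mu_0$ it holds that $\langle x,\mu_0^N\rangle\le\langle x,\mu_0\rangle<\infty$ and that $\mu_0^N\Rightarrow\mu_0$ weakly as $N\to\infty$. Result (S) (sub-linear growth of $W_N$): under the assumptions (H) on the initial data, if $\langle x,\mu_0^N\rangle=W_N/N\to0$ as $N\to\infty$ (which is in particular true if $w_0<\infty$), then $\lim_{N\to\infty}\mu_t^N=\delta_0$ in probability for all times $t$.
   Formalization: The bound ⟨x,μ_0^N⟩ ≤ ⟨x,μ_0⟩ in (H) fails for every N, since μ_0 = δ_0 has mean 0 but ⟨x,μ_0^N⟩ = 1/N; it is replaced by finiteness of each ⟨x,μ_0^N⟩ and limsup ⟨x,μ_0^N⟩ ≤ ⟨x,μ_0⟩. *)

theory Defs
  imports "HOL-Probability.Probability"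
begin

section \<open>Configurations and empirical measures\<close>

text \<open>
  A configuration of \<open>N\<close> agents is a function on \<open>{1..N}\<close>. Measures on $[0,\infty)$ are
  represented as Borel measures on the real line that give no mass to the negative numbers.
\<close>

definition total_wealth :: "nat \<Rightarrow> (nat \<Rightarrow> real) \<Rightarrow> real" where
  "total_wealth N x = (\<Sum>i\<in>{1..N}. x i)"

definition empirical_measure :: "nat \<Rightarrow> (nat \<Rightarrow> real) \<Rightarrow> real measure" where
  "empirical_measure N x = distr (uniform_count_measure {1..N}) borel x"

lemma measure_empirical_measure:
  assumes "A \<in> sets borel"
  shows "measure (empirical_measure N x) A = (1 / real N) * (\<Sum>i\<in>{1..N}. measure (return borel (x i)) A)"
proof -
  have "measure (empirical_measure N x) A = measure (uniform_count_measure {1..N}) (x -` A \<inter> {1..N})"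
    unfolding empirical_measure_def using assms
    by (subst measure_distr) (auto simp: space_uniform_count_measure measurable_def sets_uniform_count_measure)
  also have "\<dots> = real (card (x -` A \<inter> {1..N})) / real N"
    by (subst measure_uniform_count_measure) auto
  also have "real (card (x -` A \<inter> {1..N})) = (\<Sum>i\<in>{1..N}. indicator A (x i))"
    by (simp add: indicator_def sum.If_cases Int_def conj_commute vimage_def)
  finally show ?thesis using assms by (simp add: measure_return)
qed

definition first_moment :: "real measure \<Rightarrow> ennreal" where
  "first_moment \<mu> = (\<integral>\<^sup>+x. ennreal x \<partial>\<mu>)"


section \<open>The uniform distribution on the simplex\<close>

text \<open>
  The normalised surface measure on the simplex with $N$ vertices is the image of the normalised
  Lebesgue measure on $\{y \in \mathbb{R}^{N-1} : y_i \ge 0, \sum_i y_i \le 1\}$ under the affine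
  chart that recovers the last coordinate. Which coordinate is dropped is immaterial, because the
  changes of chart are affine with determinant of modulus one. For $N = 1$ the result is the
  point mass at the configuration with the single wealth 1.
\<close>

definition simplex_chart_domain :: "nat \<Rightarrow> (nat \<Rightarrow> real) set" where
  "simplex_chart_domain N =
     {y \<in> PiE {1..<N} (\<lambda>_. UNIV). (\<forall>i\<in>{1..<N}. 0 \<le> y i) \<and> (\<Sum>i\<in>{1..<N}. y i) \<le> 1}"

definition uniform_simplex :: "nat \<Rightarrow> (nat \<Rightarrow> real) measure" where
  "uniform_simplex N =
     distr (uniform_measure (PiM {1..<N} (\<lambda>_. lborel)) (simplex_chart_domain N))
       (PiM {1..N} (\<lambda>_. borel)) (\<lambda>y. y(N := 1 - (\<Sum>i\<in>{1..<N}. y i)))"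


section \<open>Weak topology and convergence in probability\<close>

definition prob_measures_nonneg :: "real measure set" where
  "prob_measures_nonneg = {\<mu>. sets \<mu> = sets borel \<and> prob_space \<mu> \<and> emeasure \<mu> {..<0} = 0}"

text \<open>
  The coarsest topology on the probability measures on $[0,\infty)$ that makes all maps
  $\mu \mapsto \langle f, \mu\rangle$ continuous, for $f$ bounded and continuous on $[0,\infty)$.
\<close>

definition weak_topology :: "real measure topology" where
  "weak_topology = topology_generated_by
     {{\<mu> \<in> prob_measures_nonneg. (LINT x:{0..}|\<mu>. f x) \<in> V} | f V.
        continuous_on {0..} f \<and> bounded (f ` {0..}) \<and> open (V :: real set)}"

lemma topspace_weak_topology: "topspace weak_topology = prob_measures_nonneg"
proof -
  have "prob_measures_nonneg = {\<mu> \<in> prob_measures_nonneg. (LINT x:{0..}|\<mu>. 0::real) \<in> UNIV}"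
    by simp
  moreover have "continuous_on {0..} (\<lambda>_::real. 0::real)" "bounded ((\<lambda>_::real. 0::real) ` {0..})"
    "open (UNIV :: real set)" by (auto simp: bounded_iff)
  ultimately show ?thesis
    unfolding weak_topology_def topology_generated_by_topspace by blast
qed

lemma limitin_weak_topology_iff:
  assumes seq: "\<And>n. \<mu>s n \<in> prob_measures_nonneg" and lim: "\<mu> \<in> prob_measures_nonneg"
  shows "limitin weak_topology \<mu>s \<mu> sequentially \<longleftrightarrow>
    (\<forall>f. continuous_on {0..} f \<and> bounded (f ` {0..}) \<longrightarrow>
       (\<lambda>n. LINT x:{0..}|\<mu>s n. f x) \<longlonglongrightarrow> (LINT x:{0..}|\<mu>. f x :: real))"
proof safe
  fix f :: "real \<Rightarrow> real"
  assume L: "limitin weak_topology \<mu>s \<mu> sequentially"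
    and f: "continuous_on {0..} f" "bounded (f ` {0..})"
  show "(\<lambda>n. LINT x:{0..}|\<mu>s n. f x) \<longlonglongrightarrow> (LINT x:{0..}|\<mu>. f x)"
  proof (rule topological_tendstoI)
    fix V :: "real set" assume V: "open V" "(LINT x:{0..}|\<mu>. f x) \<in> V"
    let ?U = "{\<nu> \<in> prob_measures_nonneg. (LINT x:{0..}|\<nu>. f x) \<in> V}"
    have "openin weak_topology ?U"
      unfolding weak_topology_def using f V by (intro topology_generated_by_Basis) blast
    moreover have "\<mu> \<in> ?U" using lim V by simp
    ultimately have "eventually (\<lambda>n. \<mu>s n \<in> ?U) sequentially"
      using L unfolding limitin_def by blast
    then show "eventually (\<lambda>n. (LINT x:{0..}|\<mu>s n. f x) \<in> V) sequentially"
      by eventually_elim auto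
  qed
next
  assume *: "\<forall>f. continuous_on {0..} f \<and> bounded (f ` {0..}) \<longrightarrow>
       (\<lambda>n. LINT x:{0..}|\<mu>s n. f x) \<longlonglongrightarrow> (LINT x:{0..}|\<mu>. f x :: real)"
  have "eventually (\<lambda>n. \<mu>s n \<in> U) sequentially" if "openin weak_topology U" "\<mu> \<in> U" for U
    using that(1)[unfolded weak_topology_def openin_topology_generated_by_iff] that(2)
  proof (induction U rule: generate_topology_on.induct)
    case (Int a b)
    then show ?case by (auto intro: eventually_conj)
  next
    case (UN K)
    then obtain k where "k \<in> K" "\<mu> \<in> k" by blast
    with UN have "eventually (\<lambda>n. \<mu>s n \<in> k) sequentially" by blast
    then show ?case by eventually_elim (use \<open>k \<in> K\<close> in blast)
  next
    case (Basis s)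
    then obtain f V where s: "s = {\<mu> \<in> prob_measures_nonneg. (LINT x:{0..}|\<mu>. f x) \<in> V}"
      and f: "continuous_on {0..} f" "bounded (f ` {0..})" and V: "open (V :: real set)" by blast
    have "eventually (\<lambda>n. (LINT x:{0..}|\<mu>s n. f x) \<in> V) sequentially"
      using * f V Basis(2) s by (intro topological_tendstoD) auto
    then show ?case by eventually_elim (use seq s in auto)
  qed auto
  then show "limitin weak_topology \<mu>s \<mu> sequentially"
    unfolding limitin_def topspace_weak_topology using lim by blast
qed

lemma limitin_weak_topology_iff_weak_conv_m:
  assumes seq: "\<And>n. \<mu>s n \<in> prob_measures_nonneg" and lim: "\<mu> \<in> prob_measures_nonneg"
  shows "limitin weak_topology \<mu>s \<mu> sequentially \<longleftrightarrow> weak_conv_m \<mu>s \<mu>"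
proof -
  have rd: "real_distribution \<nu>" if "\<nu> \<in> prob_measures_nonneg" for \<nu>
    using that sets_eq_imp_space_eq[of \<nu> borel]
    unfolding prob_measures_nonneg_def real_distribution_def real_distribution_axioms_def by auto
  have AE0: "AE x in \<nu>. 0 \<le> x" if "\<nu> \<in> prob_measures_nonneg" for \<nu>
    using that unfolding prob_measures_nonneg_def
    by (intro AE_I[of _ _ "{..<0}"]) auto
  have restr: "(LINT x:{0..}|\<nu>. g x) = (LINT x|\<nu>. h x)"
    if "\<nu> \<in> prob_measures_nonneg" "continuous_on UNIV h" "\<And>x. 0 \<le> x \<Longrightarrow> g x = h x"
    for \<nu> and g h :: "real \<Rightarrow> real"
  proof -
    have [measurable_cong]: "sets \<nu> = sets borel"
      using that unfolding prob_measures_nonneg_def by blast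
    have [measurable]: "h \<in> borel_measurable borel"
      using that(2) by (rule borel_measurable_continuous_onI)
    have "(LINT x:{0..}|\<nu>. g x) = (LINT x|\<nu>. indicator {0..} x * h x)"
      unfolding set_lebesgue_integral_def by (intro Bochner_Integration.integral_cong)
        (auto simp: indicator_def that(3))
    also have "\<dots> = (LINT x|\<nu>. h x)"
      by (intro integral_cong_AE) (use AE0[OF that(1)] in auto)
    finally show ?thesis .
  qed
  show ?thesis
  proof
    assume "limitin weak_topology \<mu>s \<mu> sequentially"
    note L = this[unfolded limitin_weak_topology_iff[OF assms]]
    show "weak_conv_m \<mu>s \<mu>"
    proof (rule integral_bdd_continuous_conv_imp_weak_conv)
      fix f :: "real \<Rightarrow> real" assume f: "\<And>x. isCont f x" "\<And>x. \<bar>f x\<bar> \<le> 1"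
      have c: "continuous_on UNIV f" using f by (simp add: continuous_at_imp_continuous_on)
      have "continuous_on {0..} f" "bounded (f ` {0..})"
        using c f(2) by (auto intro: continuous_on_subset simp: bounded_iff)
      with L have "(\<lambda>n. LINT x:{0..}|\<mu>s n. f x) \<longlonglongrightarrow> (LINT x:{0..}|\<mu>. f x)" by blast
      then show "(\<lambda>n. integral\<^sup>L (\<mu>s n) f) \<longlonglongrightarrow> integral\<^sup>L \<mu> f"
        using restr[OF seq c] restr[OF lim c] by simp
    qed (use rd seq lim in auto)
  next
    assume W: "weak_conv_m \<mu>s \<mu>"
    show "limitin weak_topology \<mu>s \<mu> sequentially"
      unfolding limitin_weak_topology_iff[OF assms]
    proof safe
      fix f :: "real \<Rightarrow> real" assume f: "continuous_on {0..} f" "bounded (f ` {0..})"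
      define h where "h x = f (max 0 x)" for x
      have c: "continuous_on UNIV h" unfolding h_def
        by (intro continuous_on_compose2[OF f(1)] continuous_intros) auto
      obtain B where B: "\<And>x. 0 \<le> x \<Longrightarrow> norm (f x) \<le> B"
        using f(2) unfolding bounded_iff by auto
      have "(\<lambda>n. integral\<^sup>L (\<mu>s n) h) \<longlonglongrightarrow> integral\<^sup>L \<mu> h"
      proof (rule weak_conv_imp_integral_bdd_continuous_conv[OF _ _ W])
        show "isCont h x" for x using c by (simp add: continuous_on_eq_continuous_at)
        show "norm (h x) \<le> B" for x unfolding h_def by (intro B) auto
      qed (use rd seq lim in auto)
      moreover have "f x = h x" if "0 \<le> x" for x using that by (simp add: h_def)
      ultimately show "(\<lambda>n. LINT x:{0..}|\<mu>s n. f x) \<longlonglongrightarrow> (LINT x:{0..}|\<mu>. f x)"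
        using restr[OF seq c, of f] restr[OF lim c, of f] by simp
    qed
  qed
qed

text \<open>
  Convergence in probability to a constant: every neighbourhood is missed with vanishing probability.
  The measurability clause is explicit because \<^const>\<open>measure\<close> is 0 on non-measurable sets.
\<close>

definition tendsto_in_probability ::
    "'a measure \<Rightarrow> 'b topology \<Rightarrow> (nat \<Rightarrow> 'a \<Rightarrow> 'b) \<Rightarrow> 'b \<Rightarrow> bool" where
  "tendsto_in_probability M T Z c \<longleftrightarrow>
     (\<forall>U. openin T U \<and> c \<in> U \<longrightarrow>
        (\<forall>\<^sub>F N in sequentially. {\<omega> \<in> space M. Z N \<omega> \<notin> U} \<in> sets M) \<and>
        (\<lambda>N. measure M {\<omega> \<in> space M. Z N \<omega> \<notin> U}) \<longlonglongrightarrow> 0)"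


section \<open>The random-exchange dynamics\<close>

text \<open>
  A mark \<open>((i, j), r)\<close> is an ordered pair of interacting agents with the exchange fraction.
\<close>

definition exchange :: "(nat \<times> nat) \<times> real \<Rightarrow> (nat \<Rightarrow> real) \<Rightarrow> (nat \<Rightarrow> real)" where
  "exchange m x = (case m of ((i, j), r) \<Rightarrow>
     x(i := r * (x i + x j), j := (1 - r) * (x i + x j)))"

primrec after_exchanges ::
    "(nat \<Rightarrow> (nat \<times> nat) \<times> real) \<Rightarrow> (nat \<Rightarrow> real) \<Rightarrow> nat \<Rightarrow> (nat \<Rightarrow> real)" where
  "after_exchanges m x 0 = x"
| "after_exchanges m x (Suc k) = exchange (m k) (after_exchanges m x k)"

text \<open>
  The noise \<open>\<xi>\<close> lists the waiting times between successive events of the Poisson process together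
  with the marks of the events.
\<close>

definition event_count :: "(nat \<Rightarrow> real \<times> ((nat \<times> nat) \<times> real)) \<Rightarrow> real \<Rightarrow> nat" where
  "event_count \<xi> t = card {k. (\<Sum>l\<le>k. fst (\<xi> l)) \<le> t}"

definition exchange_path ::
    "(nat \<Rightarrow> real) \<Rightarrow> (nat \<Rightarrow> real \<times> ((nat \<times> nat) \<times> real)) \<Rightarrow> real \<Rightarrow> (nat \<Rightarrow> real)" where
  "exchange_path x \<xi> t = after_exchanges (\<lambda>k. snd (\<xi> k)) x (event_count \<xi> t)"

text \<open>
  Each of the $N(N-1)$ ordered pairs interacts at rate $1/N$, so the Poisson process has rate $N-1$;
  this is the total mass of the jump kernel $N\mu^{(2,N)}$ of the generator.
\<close>

definition event_law :: "nat \<Rightarrow> (real \<times> ((nat \<times> nat) \<times> real)) measure" where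
  "event_law N =
     density lborel (exponential_density (real N - 1)) \<Otimes>\<^sub>M
     (measure_pmf (pmf_of_set {(i, j). i \<in> {1..N} \<and> j \<in> {1..N} \<and> i \<noteq> j}) \<Otimes>\<^sub>M
      uniform_measure lborel {0..1})"

text \<open>
  \<open>X t \<omega>\<close> is the configuration at time \<open>t\<close> of the dynamics on \<open>M\<close> that starts from \<open>X0\<close> and is
  driven by noise independent of \<open>X0\<close>; the joint law states that the events are independent and
  identically distributed and independent of \<open>X0\<close>. A single agent never interacts.
\<close>

definition random_exchange_dynamics ::
    "'a measure \<Rightarrow> nat \<Rightarrow> ('a \<Rightarrow> nat \<Rightarrow> real) \<Rightarrow> (real \<Rightarrow> 'a \<Rightarrow> nat \<Rightarrow> real) \<Rightarrow> bool" where
  "random_exchange_dynamics M N X0 X \<longleftrightarrow>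
     (if N < 2 then \<forall>t\<ge>0. \<forall>\<omega>\<in>space M. X t \<omega> = X0 \<omega>
      else \<exists>\<xi>. \<xi> \<in> M \<rightarrow>\<^sub>M PiM UNIV (\<lambda>_. event_law N) \<and>
        distr M (PiM {1..N} (\<lambda>_. borel) \<Otimes>\<^sub>M PiM UNIV (\<lambda>_. event_law N)) (\<lambda>\<omega>. (X0 \<omega>, \<xi> \<omega>)) =
          distr M (PiM {1..N} (\<lambda>_. borel)) X0 \<Otimes>\<^sub>M PiM UNIV (\<lambda>_. event_law N) \<and>
        (\<forall>t\<ge>0. \<forall>\<omega>\<in>space M. X t \<omega> = exchange_path (X0 \<omega>) (\<xi> \<omega>) t))"


section \<open>Assumptions of the mean-field limit theorem\<close>

text \<open>
  The usual form of the moment condition is $\langle x, \mu_0^N\rangle \le \langle x, \mu_0\rangle <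
  \infty$ for all $N$. It cannot hold for $\mu_0 = \delta_0$ and positive total wealth
  (\<open>moment_bound_fails_at_zero\<close> below), so the inequality is imposed in the limit only, together
  with finiteness of every $\langle x, \mu_0^N\rangle$.
\<close>

definition mean_field_assumptions ::
    "(nat \<Rightarrow> real) \<Rightarrow> ereal \<Rightarrow> (nat \<Rightarrow> real measure) \<Rightarrow> real measure \<Rightarrow> bool" where
  "mean_field_assumptions W w0 \<mu>s \<mu>0 \<longleftrightarrow>
     (\<forall>m n. 1 \<le> m \<and> m \<le> n \<longrightarrow> W m \<le> W n) \<and>
     0 < w0 \<and> (\<lambda>N. ereal (W N)) \<longlonglongrightarrow> w0 \<and>
     (\<forall>N\<ge>1. first_moment (\<mu>s N) < \<infinity>) \<and>
     limsup (\<lambda>N. first_moment (\<mu>s N)) \<le> first_moment \<mu>0 \<and> first_moment \<mu>0 < \<infinity> \<and>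
     weak_conv_m \<mu>s \<mu>0"

lemma first_moment_empirical_measure:
  assumes "1 \<le> N" and "\<And>i. i \<in> {1..N} \<Longrightarrow> 0 \<le> x i"
  shows "first_moment (empirical_measure N x) = ennreal (total_wealth N x / real N)"
proof -
  have "first_moment (empirical_measure N x) =
      (\<integral>\<^sup>+i. ennreal (x i) \<partial>uniform_count_measure {1..N})"
    unfolding first_moment_def empirical_measure_def
  proof (subst nn_integral_distr)
    show "x \<in> uniform_count_measure {1..N} \<rightarrow>\<^sub>M borel"
      by (auto simp: measurable_def space_uniform_count_measure sets_uniform_count_measure)
  qed simp_all
  also have "\<dots> = (\<Sum>i\<in>{1..N}. ennreal (1 / real N) * ennreal (x i))"
    unfolding uniform_count_measure_def using assms
    by (subst nn_integral_point_measure_finite) (auto simp: mult.commute)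
  also have "\<dots> = ennreal (\<Sum>i\<in>{1..N}. 1 / real N * x i)"
    using assms(2) by (subst sum_ennreal[symmetric]) (auto simp flip: ennreal_mult intro!: sum.cong)
  finally show ?thesis by (simp add: total_wealth_def sum_divide_distrib)
qed

lemma moment_bound_fails_at_zero:
  assumes "1 \<le> N" and "\<And>i. i \<in> {1..N} \<Longrightarrow> 0 \<le> x i" and "0 < total_wealth N x"
  shows "\<not> first_moment (empirical_measure N x) \<le> first_moment (return borel 0)"
proof -
  have "first_moment (return borel 0) = 0"
    unfolding first_moment_def by (subst nn_integral_return) auto
  moreover have "0 < first_moment (empirical_measure N x)"
    using assms by (subst first_moment_empirical_measure) auto
  ultimately show ?thesis by simp
qed

end

theory Submission
  imports Defs
begin

text \<open>
  Almost surely, the initial configurations of all sizes lie on their simplices, and on this event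
  the convergence is deterministic. Total wealth one among \<open>N\<close> agents leaves at most
  \<open>1 / c\<close> agents with wealth above \<open>c\<close>, so by Markov's inequality the empirical measure of any
  configuration on the simplex gives mass at least \<open>1 - 1 / (c N)\<close> to $[0,c]$
  (\<open>measure_empirical_measure_atMost_ge\<close>). Therefore the empirical measures of an arbitrary
  sequence of points of the simplices converge weakly to the point mass at zero
  (\<open>weak_conv_empirical_measure\<close>), and their first moments are exactly \<open>1 / N\<close>.

  The same observation settles the dynamics at once. An exchange between two distinct agents with a
  fraction in $[0,1]$ keeps a configuration on the simplex, so at every time the configuration is
  almost surely on the simplex. Because the convergence holds along every choice of points,
  it is uniform: a neighbourhood of the point mass at zero contains the empirical measures of the
  whole simplex as soon as \<open>N\<close> is large (\<open>eventually_unit_simplex_in_neighbourhood\<close>). The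
  probability of missing the neighbourhood is then not merely small but zero.

  What remains is measurability. Convergence in probability asks for the measurability of the event
  that the empirical measure misses a weakly open set. The empirical measure depends continuously
  on a non-negative configuration (\<open>continuous_map_empirical_measure\<close>), hence the configurations
  whose empirical measure lies in an open set form a Borel set, and the configuration at a fixed
  time is a measurable function of the initial configuration and the noise
  (\<open>measurable_exchange_path\<close>).
\<close>

section \<open>Configurations on the simplex\<close>

definition nonneg_orthant :: "nat \<Rightarrow> (nat \<Rightarrow> real) set" where
  "nonneg_orthant N = {x. \<forall>i\<in>{1..N}. 0 \<le> x i}"

definition unit_simplex :: "nat \<Rightarrow> (nat \<Rightarrow> real) set" where
  "unit_simplex N = {x \<in> nonneg_orthant N. total_wealth N x = 1}"

text \<open>
  Each point of the chart domain is mapped into the simplex: the coordinate that the chart adds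
  makes the sum equal to one, and it is non-negative because the other coordinates sum to at most
  one.
\<close>

lemma AE_uniform_simplex:
  assumes "1 \<le> N"
  shows "AE x in uniform_simplex N. x \<in> unit_simplex N"
proof -
  let ?L = "PiM {1..<N} (\<lambda>_. lborel) :: (nat \<Rightarrow> real) measure"
  let ?c = "\<lambda>y :: nat \<Rightarrow> real. y(N := 1 - (\<Sum>i\<in>{1..<N}. y i))"
  have ins: "{1..N} = insert N {1..<N}" using assms by auto
  have c: "?c \<in> ?L \<rightarrow>\<^sub>M PiM {1..N} (\<lambda>_. borel)"
    unfolding ins
  proof (rule measurable_fun_upd[where J = "{1..<N}"])
    show "(\<lambda>y. y) \<in> ?L \<rightarrow>\<^sub>M PiM {1..<N} (\<lambda>_. borel)"
      by (subst measurable_cong_sets[OF refl sets_PiM_cong[of _ _ "\<lambda>_. borel" "\<lambda>_. lborel"]]) auto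
    show "(\<lambda>y. 1 - (\<Sum>i\<in>{1..<N}. y i)) \<in> borel_measurable ?L"
      by measurable
  qed simp
  have dom: "simplex_chart_domain N \<in> sets ?L"
  proof -
    have "simplex_chart_domain N =
        {y \<in> space ?L. (\<forall>i\<in>{1..<N}. 0 \<le> y i) \<and> (\<Sum>i\<in>{1..<N}. y i) \<le> 1}"
      by (auto simp: simplex_chart_domain_def space_PiM)
    also have "\<dots> \<in> sets ?L" by measurable
    finally show ?thesis .
  qed
  have on_simplex: "?c y \<in> unit_simplex N" if "y \<in> simplex_chart_domain N" for y
    using that assms unfolding ins unit_simplex_def nonneg_orthant_def total_wealth_def
      simplex_chart_domain_def by (auto simp: ins intro!: sum.cong)
  have meas: "{x \<in> space (PiM {1..N} (\<lambda>_. borel)). x \<in> unit_simplex N} \<in>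
      sets (PiM {1..N} (\<lambda>_. borel))"
    unfolding unit_simplex_def nonneg_orthant_def total_wealth_def mem_Collect_eq by measurable
  show ?thesis
    unfolding uniform_simplex_def
    by (subst AE_distr_iff[OF _ meas])
      (use c in simp, use on_simplex dom in \<open>auto intro!: AE_uniform_measureI\<close>)
qed


section \<open>Empirical measures of non-negative configurations\<close>

text \<open>
  A negative wealth carries mass \<open>1 / N\<close>. The direction from left to right identifies the
  preimage of a weakly open set as a subset of the orthant, which makes it a Borel set below.
\<close>

lemma empirical_measure_in_prob_measures_nonneg_iff:
  assumes "1 \<le> N"
  shows "empirical_measure N x \<in> prob_measures_nonneg \<longleftrightarrow> x \<in> nonneg_orthant N"
proof -
  have m: "x \<in> uniform_count_measure {1..N} \<rightarrow>\<^sub>M borel"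
    by (auto simp: measurable_def space_uniform_count_measure sets_uniform_count_measure)
  have p: "prob_space (empirical_measure N x)"
    unfolding empirical_measure_def
    by (rule prob_space.prob_space_distr[OF prob_space_uniform_count_measure m]) (use assms in auto)
  then interpret prob_space "empirical_measure N x" .
  have "emeasure (empirical_measure N x) {..<0} = 0 \<longleftrightarrow> measure (empirical_measure N x) {..<0} = 0"
    by (simp add: emeasure_eq_measure)
  also have "\<dots> \<longleftrightarrow> (\<Sum>i\<in>{1..N}. measure (return borel (x i)) {..<0}) = 0"
    using assms by (subst measure_empirical_measure) auto
  also have "\<dots> \<longleftrightarrow> x \<in> nonneg_orthant N"
    by (subst sum_nonneg_eq_0_iff)
      (auto simp: nonneg_orthant_def measure_return indicator_def split: if_splits)
  finally show ?thesis
    using p by (simp add: prob_measures_nonneg_def) (simp add: empirical_measure_def)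
qed

lemma set_integral_empirical_measure:
  fixes f :: "real \<Rightarrow> real"
  assumes f: "continuous_on {0..} f" and x: "x \<in> nonneg_orthant N"
  shows "(LINT y:{0..}|empirical_measure N x. f y) = (\<Sum>i\<in>{1..N}. f (x i)) / real N"
proof -
  have m: "x \<in> uniform_count_measure {1..N} \<rightarrow>\<^sub>M borel"
    by (auto simp: measurable_def space_uniform_count_measure sets_uniform_count_measure)
  have "(LINT y:{0..}|empirical_measure N x. f y) =
      (LINT i|uniform_count_measure {1..N}. indicator {0..} (x i) *\<^sub>R f (x i))"
    unfolding set_lebesgue_integral_def empirical_measure_def
    by (rule integral_distr[OF m]) (rule borel_measurable_continuous_on_indicator[OF _ f], simp)
  also have "\<dots> = (\<Sum>i\<in>{1..N}. f (x i)) / real N"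
    using x by (simp add: integral_uniform_count_measure nonneg_orthant_def)
  finally show ?thesis .
qed

text \<open>
  It suffices to test the subbasis of the weak topology, and integrating \<open>f\<close> against the empirical
  measure gives the average of the values of \<open>f\<close> at the coordinates. Configurations carry the
  product topology on all functions of type \<open>nat \<Rightarrow> real\<close>, so each coordinate is continuous.
\<close>

lemma continuous_map_empirical_measure:
  assumes N: "1 \<le> N"
  shows "continuous_map (top_of_set (nonneg_orthant N)) weak_topology (empirical_measure N)"
  unfolding weak_topology_def
proof (rule continuous_on_generated_topo)
  let ?B = "{{\<mu> \<in> prob_measures_nonneg. (LINT x:{0..}|\<mu>. f x) \<in> V} | f V.
        continuous_on {0..} f \<and> bounded (f ` {0..}) \<and> open (V :: real set)}"
  have "\<Union> ?B = prob_measures_nonneg"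
    using topspace_weak_topology unfolding weak_topology_def topology_generated_by_topspace .
  then show "empirical_measure N ` topspace (top_of_set (nonneg_orthant N)) \<subseteq> \<Union> ?B"
    using empirical_measure_in_prob_measures_nonneg_iff[OF N] by auto
  fix U assume "U \<in> ?B"
  then obtain f V where U: "U = {\<mu> \<in> prob_measures_nonneg. (LINT x:{0..}|\<mu>. f x) \<in> V}"
    and f: "continuous_on {0..} f" and V: "open (V :: real set)" by blast
  let ?g = "\<lambda>x :: nat \<Rightarrow> real. (\<Sum>i\<in>{1..N}. f (x i)) / real N"
  have "continuous_on (nonneg_orthant N) ?g"
    using N by (intro continuous_intros continuous_on_compose2[OF f] continuous_on_coordinatewise_then_product)
       (auto simp: nonneg_orthant_def intro: continuous_on_subset[OF continuous_on_product_coordinates])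
  then have "openin (top_of_set (nonneg_orthant N)) (nonneg_orthant N \<inter> ?g -` V)"
    using V by (simp add: continuous_on_open_gen continuous_openin_preimage_gen)
  also have "nonneg_orthant N \<inter> ?g -` V =
      empirical_measure N -` U \<inter> topspace (top_of_set (nonneg_orthant N))"
    using empirical_measure_in_prob_measures_nonneg_iff[OF N]
    by (auto simp: U set_integral_empirical_measure[OF f])
  finally show "openin (top_of_set (nonneg_orthant N))
      (empirical_measure N -` U \<inter> topspace (top_of_set (nonneg_orthant N)))" .
qed

text \<open>
  By continuity the set is relatively open in the orthant, hence the intersection of an open set
  with a Borel set; and on countably many coordinates the Borel sets of the product topology are
  the product \<open>\<sigma>\<close>-algebra.
\<close>

lemma sets_empirical_measure_vimage:
  assumes N: "1 \<le> N" and U: "openin weak_topology U"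
  shows "{x. empirical_measure N x \<in> U} \<in> sets (PiM UNIV (\<lambda>_. borel))"
proof -
  have "openin (top_of_set (nonneg_orthant N)) {x \<in> nonneg_orthant N. empirical_measure N x \<in> U}"
    using openin_continuous_map_preimage[OF continuous_map_empirical_measure[OF N] U] by simp
  moreover have "U \<subseteq> prob_measures_nonneg"
    using openin_subset[OF U] by (simp add: topspace_weak_topology)
  then have "{x \<in> nonneg_orthant N. empirical_measure N x \<in> U} = {x. empirical_measure N x \<in> U}"
    using empirical_measure_in_prob_measures_nonneg_iff[OF N] by auto
  ultimately obtain G where G: "open G" "{x. empirical_measure N x \<in> U} = nonneg_orthant N \<inter> G"
    by (auto simp: openin_open)
  have "nonneg_orthant N = {x \<in> space (PiM UNIV (\<lambda>_. borel)). \<forall>i\<in>{1..N}. 0 \<le> x i}"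
    by (simp add: nonneg_orthant_def space_PiM)
  also have "\<dots> \<in> sets (PiM UNIV (\<lambda>_. borel))" by measurable
  finally show ?thesis
    using G by (auto simp: sets_PiM_equal_borel)
qed


section \<open>Weak convergence on the simplex\<close>

text \<open>
  Markov's inequality, in the form that \<open>1 - y / c\<close> is at most the indicator of \<open>y \<le> c\<close> for
  \<open>y \<ge> 0\<close>, averaged over the wealths.
\<close>

lemma measure_empirical_measure_atMost_ge:
  assumes N: "1 \<le> N" and x: "x \<in> unit_simplex N" and c: "0 < c"
  shows "1 - 1 / (c * real N) \<le> measure (empirical_measure N x) {..c}"
proof -
  have "real N - 1 / c = (\<Sum>i\<in>{1..N}. 1 - x i / c)"
    using x by (simp add: unit_simplex_def total_wealth_def sum_subtractf flip: sum_divide_distrib)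
  also have "\<dots> \<le> (\<Sum>i\<in>{1..N}. measure (return borel (x i)) {..c})"
    using x c by (intro sum_mono)
      (auto simp: measure_return indicator_def unit_simplex_def nonneg_orthant_def field_simps)
  finally have "(real N - 1 / c) / real N \<le> measure (empirical_measure N x) {..c}"
    using N by (simp add: measure_empirical_measure divide_right_mono)
  moreover have "(real N - 1 / c) / real N = 1 - 1 / (c * real N)"
    using N c by (simp add: field_simps)
  ultimately show ?thesis by simp
qed

text \<open>
  Weak convergence is tested at the continuity points of the limiting distribution function, that
  is at all \<open>c \<noteq> 0\<close>. For \<open>c < 0\<close> there is no mass on the left of \<open>c\<close>, and for \<open>c > 0\<close> the
  Markov bound applies.
\<close>

lemma weak_conv_empirical_measure:
  assumes x: "\<And>N. 1 \<le> N \<Longrightarrow> x N \<in> unit_simplex N"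
  shows "weak_conv_m (\<lambda>N. empirical_measure N (x N)) (return borel 0)"
  unfolding weak_conv_m_def weak_conv_def
proof safe
  fix c :: real assume cont: "isCont (cdf (return borel 0)) c"
  interpret r: prob_space "return borel (0::real)" by (rule prob_space_return) simp
  interpret r: real_distribution "return borel (0::real)"
    by standard auto
  have "c \<noteq> 0"
    using cont r.isCont_cdf[of c] by (auto simp: measure_return)
  then consider "c < 0" | "0 < c" by linarith
  then show "(\<lambda>N. cdf (empirical_measure N (x N)) c) \<longlonglongrightarrow> cdf (return borel 0) c"
  proof cases
    case 1
    have "cdf (empirical_measure N (x N)) c = 0" if "1 \<le> N" for N
    proof -
      have "measure (return borel (x N i)) {..c} = 0" if "i \<in> {1..N}" for i
        using x[OF \<open>1 \<le> N\<close>] that 1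
        by (force simp: unit_simplex_def nonneg_orthant_def measure_return indicator_def)
      then show ?thesis by (simp add: cdf_def measure_empirical_measure)
    qed
    then have "\<forall>\<^sub>F N in sequentially. cdf (empirical_measure N (x N)) c = 0"
      by (auto simp: eventually_sequentially)
    moreover have "cdf (return borel 0) c = 0"
      using 1 by (simp add: cdf_def measure_return)
    ultimately show ?thesis
      by (simp add: tendsto_eventually)
  next
    case 2
    have "(\<lambda>N. cdf (empirical_measure N (x N)) c) \<longlonglongrightarrow> 1"
    proof (rule tendsto_sandwich)
      show "\<forall>\<^sub>F N in sequentially. 1 - 1 / (c * real N) \<le> cdf (empirical_measure N (x N)) c"
        using measure_empirical_measure_atMost_ge[OF _ x 2]
        unfolding eventually_sequentially cdf_def by blast
      have "measure (empirical_measure N (x N)) {..c} \<le> 1" if "1 \<le> N" for N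
        using empirical_measure_in_prob_measures_nonneg_iff[OF that, of "x N"] x[OF that]
        by (auto simp: unit_simplex_def prob_measures_nonneg_def intro: prob_space.prob_le_1)
      then show "\<forall>\<^sub>F N in sequentially. cdf (empirical_measure N (x N)) c \<le> 1"
        unfolding eventually_sequentially cdf_def by blast
      have "(\<lambda>N. 1 - 1 / c * (1 / real N)) \<longlonglongrightarrow> 1 - 1 / c * 0"
        by (intro tendsto_intros lim_1_over_n)
      then show "(\<lambda>N. 1 - 1 / (c * real N)) \<longlonglongrightarrow> 1" by simp
    qed simp
    then show ?thesis using 2 by (simp add: cdf_def measure_return)
  qed
qed

lemma return_0_in_prob_measures_nonneg: "return borel 0 \<in> prob_measures_nonneg"
  by (auto simp: prob_measures_nonneg_def intro!: prob_space_return)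

lemma unit_simplex_nonempty:
  assumes "1 \<le> N"
  shows "unit_simplex N \<noteq> {}"
proof -
  have "(\<lambda>i. if i = 1 then 1 else 0) \<in> unit_simplex N"
    using assms by (auto simp: unit_simplex_def nonneg_orthant_def total_wealth_def)
  then show ?thesis by blast
qed

text \<open>
  Weak convergence along every sequence of points of the simplices is uniform convergence: pick for
  each \<open>N\<close> a configuration whose empirical measure is outside the neighbourhood whenever there is
  one. The empirical measures of the picked configurations still converge, so from some point on
  there was none to pick.
\<close>

lemma eventually_unit_simplex_in_neighbourhood:
  assumes U: "openin weak_topology U" "return borel 0 \<in> U"
  shows "\<forall>\<^sub>F N in sequentially. \<forall>x\<in>unit_simplex N. empirical_measure N x \<in> U"
proof -
  define y where "y N = (SOME x. x \<in> unit_simplex N \<and>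
    ((\<exists>z\<in>unit_simplex N. empirical_measure N z \<notin> U) \<longrightarrow> empirical_measure N x \<notin> U))" for N
  have y: "y N \<in> unit_simplex N"
    "(\<exists>z\<in>unit_simplex N. empirical_measure N z \<notin> U) \<Longrightarrow> empirical_measure N (y N) \<notin> U"
    if "1 \<le> N" for N
  proof -
    have "\<exists>x. x \<in> unit_simplex N \<and>
      ((\<exists>z\<in>unit_simplex N. empirical_measure N z \<notin> U) \<longrightarrow> empirical_measure N x \<notin> U)"
      using unit_simplex_nonempty[OF that] by blast
    note s = someI_ex[OF this, folded y_def]
    show "y N \<in> unit_simplex N"
      "(\<exists>z\<in>unit_simplex N. empirical_measure N z \<notin> U) \<Longrightarrow> empirical_measure N (y N) \<notin> U"
      using s by auto
  qed
  \<comment> \<open>The index is shifted by one because the empirical measure of no agents is not a probability measure.\<close>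
  have pm: "empirical_measure (Suc n) (y (Suc n)) \<in> prob_measures_nonneg" for n
    using y(1)[of "Suc n"] empirical_measure_in_prob_measures_nonneg_iff[of "Suc n"]
    by (simp add: unit_simplex_def)
  have "weak_conv_m (\<lambda>N. empirical_measure N (y N)) (return borel 0)"
    by (rule weak_conv_empirical_measure) (rule y)
  then have "weak_conv_m (\<lambda>n. empirical_measure (Suc n) (y (Suc n))) (return borel 0)"
    unfolding weak_conv_m_def weak_conv_def using LIMSEQ_Suc by blast
  then have "limitin weak_topology (\<lambda>n. empirical_measure (Suc n) (y (Suc n))) (return borel 0)
      sequentially"
    using limitin_weak_topology_iff_weak_conv_m[OF pm return_0_in_prob_measures_nonneg] by simp
  then have "\<forall>\<^sub>F n in sequentially. empirical_measure (Suc n) (y (Suc n)) \<in> U"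
    using U unfolding limitin_def by blast
  then have "\<forall>\<^sub>F n in sequentially. \<forall>x\<in>unit_simplex (Suc n). empirical_measure (Suc n) x \<in> U"
    by eventually_elim (use y(2) in force)
  then show ?thesis
    by (subst (asm) eventually_sequentially_Suc)
qed


section \<open>First moments and the mean-field assumptions\<close>

lemma first_moment_unit_simplex:
  assumes "1 \<le> N" and "x \<in> unit_simplex N"
  shows "first_moment (empirical_measure N x) = ennreal (1 / real N)"
proof -
  have "first_moment (empirical_measure N x) = ennreal (total_wealth N x / real N)"
    using assms
    by (intro first_moment_empirical_measure) (auto simp: unit_simplex_def nonneg_orthant_def)
  then show ?thesis using assms by (simp add: unit_simplex_def)
qed

lemma tendsto_first_moment_unit_simplex:
  assumes "\<And>N. 1 \<le> N \<Longrightarrow> x N \<in> unit_simplex N"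
  shows "(\<lambda>N. first_moment (empirical_measure N (x N))) \<longlonglongrightarrow> 0"
proof -
  have "(\<lambda>N. ennreal (1 / real N)) \<longlonglongrightarrow> ennreal 0"
    by (intro tendsto_ennrealI lim_1_over_n)
  then have "(\<lambda>N. ennreal (1 / real N)) \<longlonglongrightarrow> 0" by simp
  moreover have "\<forall>\<^sub>F N in sequentially.
      ennreal (1 / real N) = first_moment (empirical_measure N (x N))"
    using first_moment_unit_simplex[OF _ assms]
    unfolding eventually_sequentially by metis
  ultimately show ?thesis by (rule Lim_transform_eventually)
qed

lemma mean_field_assumptions_unit_simplex:
  assumes x: "\<And>N. 1 \<le> N \<Longrightarrow> x N \<in> unit_simplex N"
  shows "mean_field_assumptions (\<lambda>N. total_wealth N (x N)) 1
    (\<lambda>N. empirical_measure N (x N)) (return borel 0)"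
  unfolding mean_field_assumptions_def
proof (intro conjI allI impI)
  have total: "total_wealth N (x N) = 1" if "1 \<le> N" for N
    using x[OF that] by (simp add: unit_simplex_def)
  show "total_wealth m (x m) \<le> total_wealth n (x n)" if "1 \<le> m \<and> m \<le> n" for m n
    using that total[of m] total[of n] by linarith
  have "\<forall>\<^sub>F N in sequentially. ereal (total_wealth N (x N)) = 1"
    unfolding eventually_sequentially one_ereal_def using total by blast
  then show "(\<lambda>N. ereal (total_wealth N (x N))) \<longlonglongrightarrow> 1"
    by (rule tendsto_eventually)
  show "first_moment (empirical_measure N (x N)) < \<infinity>" if "1 \<le> N" for N
    by (simp add: first_moment_unit_simplex[OF that x[OF that]])
  have "limsup (\<lambda>N. first_moment (empirical_measure N (x N))) = 0"
    by (intro lim_imp_Limsup tendsto_first_moment_unit_simplex x) simp_all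
  then show "limsup (\<lambda>N. first_moment (empirical_measure N (x N))) \<le> first_moment (return borel 0)"
    by simp
  show "first_moment (return borel 0) < \<infinity>"
    by (simp add: first_moment_def nn_integral_return)
  show "weak_conv_m (\<lambda>N. empirical_measure N (x N)) (return borel 0)"
    by (rule weak_conv_empirical_measure) (rule x)
qed simp


section \<open>The exchange dynamics\<close>

definition admissible_marks :: "nat \<Rightarrow> ((nat \<times> nat) \<times> real) set" where
  "admissible_marks N = {(i, j). i \<in> {1..N} \<and> j \<in> {1..N} \<and> i \<noteq> j} \<times> {0..1}"

text \<open>
  Distinctness of the two agents matters: for \<open>i = j\<close> the second update would overwrite the first
  and multiply the wealth of that agent by \<open>2 * (1 - r)\<close>.
\<close>

lemma exchange_in_unit_simplex:
  assumes x: "x \<in> unit_simplex N" and m: "m \<in> admissible_marks N"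
  shows "exchange m x \<in> unit_simplex N"
proof -
  obtain i j r where m_eq: "m = ((i, j), r)" by (metis surj_pair)
  with m have ij: "i \<in> {1..N}" "j \<in> {1..N}" "i \<noteq> j" and r: "0 \<le> r" "r \<le> 1"
    by (auto simp: admissible_marks_def)
  have dec: "total_wealth N z = z i + z j + (\<Sum>k\<in>{1..N} - {i, j}. z k)" for z
  proof -
    have "(\<Sum>k\<in>{1..N}. z k) = (\<Sum>k\<in>{1..N} - {i, j}. z k) + (\<Sum>k\<in>{i, j}. z k)"
      by (rule sum.subset_diff) (use ij in auto)
    then show ?thesis using ij(3) by (simp add: total_wealth_def)
  qed
  have "(\<Sum>k\<in>{1..N} - {i, j}. exchange m x k) = (\<Sum>k\<in>{1..N} - {i, j}. x k)"
    by (intro sum.cong) (auto simp: exchange_def m_eq)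
  then have "total_wealth N (exchange m x) = total_wealth N x"
    using ij(3) by (simp add: dec) (simp add: exchange_def m_eq algebra_simps)
  moreover have "0 \<le> exchange m x k" if "k \<in> {1..N}" for k
    using x ij r that by (auto simp: exchange_def m_eq unit_simplex_def nonneg_orthant_def)
  ultimately show ?thesis using x by (auto simp: unit_simplex_def nonneg_orthant_def)
qed

lemma exchange_path_in_unit_simplex:
  assumes "x \<in> unit_simplex N" and "\<And>k. snd (\<xi> k) \<in> admissible_marks N"
  shows "exchange_path x \<xi> t \<in> unit_simplex N"
proof -
  have "after_exchanges (\<lambda>k. snd (\<xi> k)) x n \<in> unit_simplex N" for n
    by (induction n) (use assms exchange_in_unit_simplex in auto)
  then show ?thesis by (simp add: exchange_path_def)
qed

lemma sets_event_law:
  "sets (event_law N) = sets (borel \<Otimes>\<^sub>M (count_space UNIV \<Otimes>\<^sub>M borel))"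
  unfolding event_law_def by (intro sets_pair_measure_cong) auto

lemma finite_nonempty_pairs:
  assumes "2 \<le> N"
  shows "finite {(i, j). i \<in> {1..N} \<and> j \<in> {1..N} \<and> i \<noteq> (j::nat)}"
    and "{(i, j). i \<in> {1..N} \<and> j \<in> {1..N} \<and> i \<noteq> (j::nat)} \<noteq> {}"
proof -
  show "finite {(i, j). i \<in> {1..N} \<and> j \<in> {1..N} \<and> i \<noteq> (j::nat)}"
    by (rule finite_subset[of _ "{1..N} \<times> {1..N}"]) auto
  have "(1, 2) \<in> {(i, j). i \<in> {1..N} \<and> j \<in> {1..N} \<and> i \<noteq> (j::nat)}" using assms by auto
  then show "{(i, j). i \<in> {1..N} \<and> j \<in> {1..N} \<and> i \<noteq> (j::nat)} \<noteq> {}" by blast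
qed

lemma prob_space_event_law:
  assumes "2 \<le> N"
  shows "prob_space (event_law N)"
  unfolding event_law_def using assms
  by (intro prob_space_pair prob_space_exponential_density prob_space_measure_pmf
      prob_space_uniform_measure) auto

lemma AE_event_law_admissible:
  assumes N: "2 \<le> N"
  shows "AE e in event_law N. snd e \<in> admissible_marks N"
proof -
  let ?P = "measure_pmf (pmf_of_set {(i, j). i \<in> {1..N} \<and> j \<in> {1..N} \<and> i \<noteq> j})"
  let ?R = "uniform_measure lborel {0..1::real}"
  interpret E: prob_space "density lborel (exponential_density (real N - 1))"
    using N by (intro prob_space_exponential_density) auto
  interpret R: prob_space ?R by (rule prob_space_uniform_measure) auto
  interpret PR: pair_prob_space ?P ?R ..
  interpret EPR: pair_prob_space "density lborel (exponential_density (real N - 1))" "?P \<Otimes>\<^sub>M ?R" ..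
  have adm: "admissible_marks N \<in> sets (?P \<Otimes>\<^sub>M ?R)"
    unfolding admissible_marks_def by (intro pair_measureI) auto
  have "{m \<in> space (?P \<Otimes>\<^sub>M ?R). m \<in> admissible_marks N} = admissible_marks N"
    using sets.sets_into_space[OF adm] by blast
  with adm have meas:
    "{m \<in> space (?P \<Otimes>\<^sub>M ?R). m \<in> admissible_marks N} \<in> sets (?P \<Otimes>\<^sub>M ?R)"
    by (simp only:)
  have "AE p in ?P. p \<in> {(i, j). i \<in> {1..N} \<and> j \<in> {1..N} \<and> i \<noteq> j}"
    using finite_nonempty_pairs[OF N] by (simp add: AE_measure_pmf_iff)
  moreover have "AE r in ?R. r \<in> {0..1}" by (intro AE_uniform_measureI) auto
  ultimately have "AE p in ?P. AE r in ?R. (p, r) \<in> admissible_marks N"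
    by (auto simp: admissible_marks_def)
  then have "AE m in ?P \<Otimes>\<^sub>M ?R. m \<in> admissible_marks N"
    by (intro PR.AE_pair_measure meas)
  then show ?thesis
    unfolding event_law_def
  proof (intro EPR.AE_pair_measure)
    show "{e \<in> space (density lborel (exponential_density (real N - 1)) \<Otimes>\<^sub>M (?P \<Otimes>\<^sub>M ?R)).
        snd e \<in> admissible_marks N} \<in>
        sets (density lborel (exponential_density (real N - 1)) \<Otimes>\<^sub>M (?P \<Otimes>\<^sub>M ?R))"
      by (rule measurable_sets_Collect[OF measurable_snd meas])
  qed simp
qed

text \<open>
  Indices of agents take countably many values, so the wealth of a randomly chosen agent is
  measurable.
\<close>

lemma measurable_exchange:
  assumes m: "m \<in> M \<rightarrow>\<^sub>M count_space UNIV \<Otimes>\<^sub>M borel" and y: "y \<in> M \<rightarrow>\<^sub>M PiM UNIV (\<lambda>_. borel)"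
  shows "(\<lambda>\<omega>. exchange (m \<omega>) (y \<omega>)) \<in> M \<rightarrow>\<^sub>M PiM UNIV (\<lambda>_. borel)"
proof -
  have p: "(\<lambda>\<omega>. fst (m \<omega>)) \<in> M \<rightarrow>\<^sub>M count_space UNIV"
    and r[measurable]: "(\<lambda>\<omega>. snd (m \<omega>)) \<in> borel_measurable M"
    using m by measurable
  have i[measurable]: "(\<lambda>\<omega>. fst (fst (m \<omega>))) \<in> M \<rightarrow>\<^sub>M count_space UNIV"
    and j[measurable]: "(\<lambda>\<omega>. snd (fst (m \<omega>))) \<in> M \<rightarrow>\<^sub>M count_space UNIV"
    by (rule measurable_compose[OF p]; simp)+
  have y_n[measurable]: "(\<lambda>\<omega>. y \<omega> n) \<in> borel_measurable M" for n using y by measurable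
  have [measurable]: "(\<lambda>\<omega>. y \<omega> (fst (fst (m \<omega>)))) \<in> borel_measurable M"
    "(\<lambda>\<omega>. y \<omega> (snd (fst (m \<omega>)))) \<in> borel_measurable M"
    by (rule measurable_compose_countable[OF y_n]; rule i j)+
  have "exchange (m \<omega>) (y \<omega>) = (\<lambda>n.
      if snd (fst (m \<omega>)) = n then
        (1 - snd (m \<omega>)) * (y \<omega> (fst (fst (m \<omega>))) + y \<omega> (snd (fst (m \<omega>))))
      else if fst (fst (m \<omega>)) = n then
        snd (m \<omega>) * (y \<omega> (fst (fst (m \<omega>))) + y \<omega> (snd (fst (m \<omega>))))
      else y \<omega> n)" for \<omega>
    by (auto simp: exchange_def split: prod.splits)
  then show ?thesis
    by (simp only:) (rule measurable_abs_UNIV, measurable)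
qed

text \<open>
  The number of events up to time \<open>t\<close> is a measurable natural number, and after each fixed number
  of exchanges the configuration is measurable. The target is the product over all indices: on the
  null event that a mark names an agent outside \<open>{1..N}\<close>, an exchange changes coordinates there.
\<close>

lemma measurable_exchange_path:
  assumes x: "x \<in> M \<rightarrow>\<^sub>M PiM {1..N} (\<lambda>_. borel)"
    and \<xi>: "\<xi> \<in> M \<rightarrow>\<^sub>M PiM UNIV (\<lambda>_. event_law N)"
  shows "(\<lambda>\<omega>. exchange_path (x \<omega>) (\<xi> \<omega>) t) \<in> M \<rightarrow>\<^sub>M PiM UNIV (\<lambda>_. borel)"
proof -
  have "(\<lambda>\<omega>. \<xi> \<omega> k) \<in> M \<rightarrow>\<^sub>M event_law N" for k
    using \<xi> by measurable
  then have [measurable]: "(\<lambda>\<omega>. \<xi> \<omega> k) \<in> M \<rightarrow>\<^sub>M borel \<Otimes>\<^sub>M (count_space UNIV \<Otimes>\<^sub>M borel)" for k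
    by (simp add: measurable_cong_sets[OF refl sets_event_law])
  \<comment> \<open>Outside the index set, elements of the product space take a fixed default value.\<close>
  have x_n: "(\<lambda>\<omega>. x \<omega> n) \<in> borel_measurable M" for n
  proof (cases "n \<in> {1..N}")
    case True
    then show ?thesis using x by measurable
  next
    case False
    then have "x \<omega> n = undefined" if "\<omega> \<in> space M" for \<omega>
      using measurable_space[OF x that] by (auto simp: space_PiM PiE_def extensional_def)
    then show ?thesis by (simp cong: measurable_cong)
  qed
  have "(\<lambda>\<omega>. after_exchanges (\<lambda>k. snd (\<xi> \<omega> k)) (x \<omega>) n) \<in> M \<rightarrow>\<^sub>M PiM UNIV (\<lambda>_. borel)" for n
  proof (induction n)
    case 0
    show ?case by simp (rule measurable_abs_UNIV[OF x_n])
  next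
    case (Suc n)
    then show ?case by simp (rule measurable_exchange, measurable)
  qed
  moreover have "(\<lambda>\<omega>. event_count (\<xi> \<omega>) t) \<in> M \<rightarrow>\<^sub>M count_space UNIV"
    unfolding event_count_def by measurable
  ultimately show ?thesis
    unfolding exchange_path_def by (rule measurable_compose_countable)
qed

text \<open>
  The law of the noise is the second marginal of the joint law, so a property that holds almost
  surely for the product law of the events holds almost surely for the noise.
\<close>

lemma AE_noise_admissible:
  fixes x :: "'a \<Rightarrow> nat \<Rightarrow> real" and \<xi> :: "'a \<Rightarrow> nat \<Rightarrow> real \<times> ((nat \<times> nat) \<times> real)"
  assumes M: "prob_space M" and N: "2 \<le> N"
    and x: "x \<in> M \<rightarrow>\<^sub>M PiM {1..N} (\<lambda>_. borel)"
    and \<xi>: "\<xi> \<in> M \<rightarrow>\<^sub>M PiM UNIV (\<lambda>_. event_law N)"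
    and joint: "distr M (PiM {1..N} (\<lambda>_. borel) \<Otimes>\<^sub>M PiM UNIV (\<lambda>_. event_law N)) (\<lambda>\<omega>. (x \<omega>, \<xi> \<omega>)) =
      distr M (PiM {1..N} (\<lambda>_. borel)) x \<Otimes>\<^sub>M PiM UNIV (\<lambda>_. event_law N)"
  shows "AE \<omega> in M. \<forall>k. snd (\<xi> \<omega> k) \<in> admissible_marks N"
proof -
  let ?D = "distr M (PiM {1..N} (\<lambda>_. borel)) x" and ?E = "PiM (UNIV :: nat set) (\<lambda>_. event_law N)"
  interpret D: prob_space ?D by (rule prob_space.prob_space_distr[OF M x])
  interpret E: prob_space ?E by (rule prob_space_PiM) (rule prob_space_event_law[OF N])
  interpret DE: pair_prob_space ?D ?E ..
  have "AE e in ?E. snd (e k) \<in> admissible_marks N" for k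
    by (rule AE_PiM_component[where P = "\<lambda>e. snd e \<in> admissible_marks N"])
      (use prob_space_event_law[OF N] AE_event_law_admissible[OF N] in auto)
  then have E: "AE e in ?E. \<forall>k. snd (e k) \<in> admissible_marks N"
    by (simp add: AE_all_countable)
  have sn: "snd \<in> event_law N \<rightarrow>\<^sub>M count_space UNIV \<Otimes>\<^sub>M borel"
    by (simp add: measurable_cong_sets[OF sets_event_law refl])
  have adm: "admissible_marks N \<in> sets (count_space UNIV \<Otimes>\<^sub>M borel)"
    unfolding admissible_marks_def by (intro pair_measureI) auto
  have "AE p in ?D \<Otimes>\<^sub>M ?E. \<forall>k. snd (snd p k) \<in> admissible_marks N"
  proof (rule DE.AE_pair_measure)
    have [measurable]: "(\<lambda>p. snd (snd p k)) \<in> ?D \<Otimes>\<^sub>M ?E \<rightarrow>\<^sub>M count_space UNIV \<Otimes>\<^sub>M borel" for k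
      by (rule measurable_compose[OF _ sn]) measurable
    show "{p \<in> space (?D \<Otimes>\<^sub>M ?E). \<forall>k. snd (snd p k) \<in> admissible_marks N} \<in> sets (?D \<Otimes>\<^sub>M ?E)"
      using adm by measurable
  qed (use E in auto)
  then have "AE p in distr M (PiM {1..N} (\<lambda>_. borel) \<Otimes>\<^sub>M ?E) (\<lambda>\<omega>. (x \<omega>, \<xi> \<omega>)).
      \<forall>k. snd (snd p k) \<in> admissible_marks N"
    unfolding joint .
  from AE_distrD[OF _ this] show ?thesis using x \<xi> by simp
qed

lemma exchange_dynamics_tendsto_in_probability:
  assumes M: "prob_space M"
    and X0: "\<And>N. 1 \<le> N \<Longrightarrow> X0 N \<in> M \<rightarrow>\<^sub>M PiM {1..N} (\<lambda>_. borel)"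
    and simplex: "\<And>N. 1 \<le> N \<Longrightarrow> AE \<omega> in M. X0 N \<omega> \<in> unit_simplex N"
    and X: "\<And>N. 1 \<le> N \<Longrightarrow> random_exchange_dynamics M N (X0 N) (X N)"
    and t: "0 \<le> t"
  shows "tendsto_in_probability M weak_topology (\<lambda>N \<omega>. empirical_measure N (X N t \<omega>)) (return borel 0)"
  unfolding tendsto_in_probability_def
proof (intro allI impI)
  interpret prob_space M by (rule M)
  fix U assume U: "openin weak_topology U \<and> return borel 0 \<in> U"
  \<comment> \<open>A single agent follows a different rule, but only large \<open>N\<close> matter.\<close>
  have *: "{\<omega> \<in> space M. empirical_measure N (X N t \<omega>) \<notin> U} \<in> sets M \<and>
      measure M {\<omega> \<in> space M. empirical_measure N (X N t \<omega>) \<notin> U} = 0"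
    if N: "2 \<le> N" and inU: "\<forall>x\<in>unit_simplex N. empirical_measure N x \<in> U" for N
  proof -
    have N1: "1 \<le> N" using N by simp
    obtain \<xi> where \<xi>: "\<xi> \<in> M \<rightarrow>\<^sub>M PiM UNIV (\<lambda>_. event_law N)"
      and joint: "distr M (PiM {1..N} (\<lambda>_. borel) \<Otimes>\<^sub>M PiM UNIV (\<lambda>_. event_law N)) (\<lambda>\<omega>. (X0 N \<omega>, \<xi> \<omega>)) =
        distr M (PiM {1..N} (\<lambda>_. borel)) (X0 N) \<Otimes>\<^sub>M PiM UNIV (\<lambda>_. event_law N)"
      and paths: "\<forall>s\<ge>0. \<forall>\<omega>\<in>space M. X N s \<omega> = exchange_path (X0 N \<omega>) (\<xi> \<omega>) s"
      using X[OF N1] N unfolding random_exchange_dynamics_def if_not_P[OF leD[OF N]] by blast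
    from paths t have path: "X N t \<omega> = exchange_path (X0 N \<omega>) (\<xi> \<omega>) t" if "\<omega> \<in> space M" for \<omega>
      using that by blast
    have "(\<lambda>\<omega>. exchange_path (X0 N \<omega>) (\<xi> \<omega>) t) -` {x. empirical_measure N x \<in> U} \<inter> space M \<in> sets M"
      using U by (intro measurable_sets[OF measurable_exchange_path[OF X0[OF N1] \<xi>]]
          sets_empirical_measure_vimage[OF N1]) auto
    then have "space M - (\<lambda>\<omega>. exchange_path (X0 N \<omega>) (\<xi> \<omega>) t) -` {x. empirical_measure N x \<in> U} \<inter> space M
        \<in> sets M" by (rule sets.compl_sets)
    also have "space M - (\<lambda>\<omega>. exchange_path (X0 N \<omega>) (\<xi> \<omega>) t) -` {x. empirical_measure N x \<in> U} \<inter> space M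
        = {\<omega> \<in> space M. empirical_measure N (X N t \<omega>) \<notin> U}"
      using path by auto
    finally have meas: "{\<omega> \<in> space M. empirical_measure N (X N t \<omega>) \<notin> U} \<in> sets M" .
    have "AE \<omega> in M. empirical_measure N (X N t \<omega>) \<in> U"
      using simplex[OF N1] AE_noise_admissible[OF M N X0[OF N1] \<xi> joint] AE_space
    proof eventually_elim
      case (elim \<omega>)
      then show ?case using inU path exchange_path_in_unit_simplex by simp
    qed
    then show ?thesis using meas prob_Collect_eq_0[OF meas] by simp
  qed
  have ev: "\<forall>\<^sub>F N in sequentially. 2 \<le> N \<and> (\<forall>x\<in>unit_simplex N. empirical_measure N x \<in> U)"
    using eventually_unit_simplex_in_neighbourhood U
    by (intro eventually_conj eventually_ge_at_top) auto
  show "(\<forall>\<^sub>F N in sequentially. {\<omega> \<in> space M. empirical_measure N (X N t \<omega>) \<notin> U} \<in> sets M) \<and>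
      (\<lambda>N. measure M {\<omega> \<in> space M. empirical_measure N (X N t \<omega>) \<notin> U}) \<longlonglongrightarrow> 0"
    by (intro conjI tendsto_eventually; rule eventually_mono[OF ev]; use * in blast)
qed


section \<open>Uniformly distributed initial configurations\<close>

theorem proposition2p6:
  fixes M :: "'a measure" and X0 :: "nat \<Rightarrow> 'a \<Rightarrow> nat \<Rightarrow> real"
  assumes "prob_space M"
    and "\<And>N. 1 \<le> N \<Longrightarrow> X0 N \<in> M \<rightarrow>\<^sub>M PiM {1..N} (\<lambda>_. borel)"
    and "\<And>N. 1 \<le> N \<Longrightarrow> distr M (PiM {1..N} (\<lambda>_. borel)) (X0 N) = uniform_simplex N"
  shows "(AE \<omega> in M. weak_conv_m (\<lambda>N. empirical_measure N (X0 N \<omega>)) (return borel 0)) \<and>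
    (AE \<omega> in M. (\<forall>N\<ge>1. total_wealth N (X0 N \<omega>) = 1) \<and>
       mean_field_assumptions (\<lambda>N. total_wealth N (X0 N \<omega>)) 1
         (\<lambda>N. empirical_measure N (X0 N \<omega>)) (return borel 0)) \<and>
    (AE \<omega> in M. (\<forall>N\<ge>1. first_moment (empirical_measure N (X0 N \<omega>)) =
         ennreal (total_wealth N (X0 N \<omega>) / real N)) \<and>
       (\<lambda>N. first_moment (empirical_measure N (X0 N \<omega>))) \<longlonglongrightarrow> 0) \<and>
    (\<forall>X. (\<forall>N\<ge>1. random_exchange_dynamics M N (X0 N) (X N)) \<longrightarrow>
       (\<forall>t\<ge>0. tendsto_in_probability M weak_topology
          (\<lambda>N \<omega>. empirical_measure N (X N t \<omega>)) (return borel 0)))"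
proof -
  have simplex: "AE \<omega> in M. X0 N \<omega> \<in> unit_simplex N" if "1 \<le> N" for N
    using AE_distrD[OF assms(2)[OF that], of "\<lambda>x. x \<in> unit_simplex N"] AE_uniform_simplex[OF that]
    unfolding assms(3)[OF that] by blast
  have "AE \<omega> in M. \<forall>N. 1 \<le> N \<longrightarrow> X0 N \<omega> \<in> unit_simplex N"
    unfolding AE_all_countable using simplex by auto
  then have AE_simplex: "AE \<omega> in M. \<forall>N\<ge>1. X0 N \<omega> \<in> unit_simplex N" .
  show ?thesis
  proof (intro conjI allI impI)
    show "AE \<omega> in M. weak_conv_m (\<lambda>N. empirical_measure N (X0 N \<omega>)) (return borel 0)"
      using AE_simplex by eventually_elim (rule weak_conv_empirical_measure, simp)
    show "AE \<omega> in M. (\<forall>N\<ge>1. total_wealth N (X0 N \<omega>) = 1) \<and>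
       mean_field_assumptions (\<lambda>N. total_wealth N (X0 N \<omega>)) 1
         (\<lambda>N. empirical_measure N (X0 N \<omega>)) (return borel 0)"
      using AE_simplex
    proof eventually_elim
      case (elim \<omega>)
      then show ?case
        using mean_field_assumptions_unit_simplex[of "\<lambda>N. X0 N \<omega>"] by (simp add: unit_simplex_def)
    qed
    show "AE \<omega> in M. (\<forall>N\<ge>1. first_moment (empirical_measure N (X0 N \<omega>)) =
         ennreal (total_wealth N (X0 N \<omega>) / real N)) \<and>
       (\<lambda>N. first_moment (empirical_measure N (X0 N \<omega>))) \<longlonglongrightarrow> 0"
      using AE_simplex
    proof eventually_elim
      case (elim \<omega>)
      then have "total_wealth N (X0 N \<omega>) = 1" if "1 \<le> N" for N
        using that by (simp add: unit_simplex_def)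
      then show ?case
        using elim first_moment_unit_simplex tendsto_first_moment_unit_simplex[of "\<lambda>N. X0 N \<omega>"] by simp
    qed
    fix X and t :: real
    assume "\<forall>N\<ge>1. random_exchange_dynamics M N (X0 N) (X N)" and "0 \<le> t"
    then show "tendsto_in_probability M weak_topology
          (\<lambda>N \<omega>. empirical_measure N (X N t \<omega>)) (return borel 0)"
      using exchange_dynamics_tendsto_in_probability[OF assms(1,2) simplex] by blast
  qed
qed

end
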